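(* The backward projection (antichain) algorithm described in the context is a sound algorithm for solving the $(\mathbf{CS,MT})$-reachability problem with finitely generated monotone target set $H$ (that is, $H$ is upward-closed or downward-closed, and finitely generated). Explicitly: for every input consisting of an MDP $\mathcal{M}=(Q,\mathsf{Act},(M_a)_{a\in\mathsf{Act}})$, an initial configuration $d_0\in\mathcal{D}(Q)$, a finitely generated monotone target set $H\subseteq[0,1]^Q$ given by its finite generating antichain (its set $\lfloor H\rfloor$ of minimal elements if $H$ is upward-closed, its set $\lceil H\rceil$ of maximal elements if $H$ is downward-closed), and parameters $K,L\in\mathbb{N}$, if a run of the algorithm returns True, then $H$ is reachable from $d_0$, i.e. there is a finite sequence of actions $a_1\cdots a_n\in\mathsf{Act}^{*}$ with $M_{a_n}^{T}\cdots M_{a_1}^{T}d_0\in H$.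
   Context: $\mathcal{D}(Q)$ is the set of probability distributions on the finite set $Q$, regarded as column vectors in $[0,1]^Q$; its elements are called configurations. An MDP $\mathcal{M}=(Q,\mathsf{Act},(M_a)_{a\in\mathsf{Act}})$ consists of finite sets $Q$ of states and $\mathsf{Act}$ of actions and a stochastic matrix $M_a\in[0,1]^{Q\times Q}$ for each action, $(M_a)_{q,q'}$ being the probability of moving from $q$ to $q'$ under $a$. Under the $(\mathbf{CS,MT})$ semantics (chance-interpreted scheduler, mass-interpreted transitions) with a pure scheduler, choosing action $a$ in configuration $d\in\mathcal{D}(Q)$ moves deterministically to $M_a^{T}d$; the $(\mathbf{CS,MT})$-reachability problem asks whether some finite sequence of actions leads from $d_0$ to a configuration in $H$. $[0,1]^Q$ is ordered componentwise by $\preceq$. For $T\subseteq[0,1]^Q$, $\uparrow T=\{y\in[0,1]^Q\mid\exists x\in T,\ x\preceq y\}$ and $\downarrow T=\{y\in[0,1]^Q\mid\exists x\in T,\ y\preceq x\}$. A set is upward-closed if it equals its own $\uparrow$, downward-closed if it equals its own $\downarrow$, and monotone if it is upward-closed or downward-closed. An upward-closed (resp. downward-closed) set is finitely generated if it is $\uparrow T$ (resp. $\downarrow T$) for some finite $T$. $\lfloor T\rfloor$ and $\lceil T\rceil$ denote the sets of $\preceq$-minimal and $\preceq$-maximal elements of $T$. Finite antichains represent the upward-closed (resp. downward-closed) sets they generate. The algorithm for upward-closed $H$: **Subroutine** (given $M$ stochastic, $\mathbf{x}\in[0,1]^Q$, $K$, $L$). For $k=1,2,\dots$: sample $(\mathbf{q}_j)_{j\in\{1,\dots,k-1\}}\in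 Q^{k-1}$ at random and compute a minimizer $$\mathbf{y}_k^{*}\in\arg\min_{\mathbf{y}}\ \mathbf{1}^{T}\mathbf{y}\quad\text{subject to}\quad M^{T}\mathbf{y}\succeq\mathbf{x},\ \ \mathbf{1}^{T}\mathbf{y}\le1,\ \ \mathbf{y}\succeq\mathbf{0},\ \ (\mathbf{y})_{\mathbf{q}_j}<(\mathbf{y}_j^{*})_{\mathbf{q}_j}\ \text{for all } j<k .$$ If no solution is returned, resample. Stop when $K$ solutions have been found, or when for some $k$ no solution is found after $L$ samples. Output the set of solutions found so far. **Algorithm.** Initialize $S:=\emptyset$, $S':=\lfloor H\rfloor$. Repeat: set $S:=S'$ and then $S':=\lfloor H\rfloor$; for each $M\in\{M_a\mid a\in\mathsf{Act}\}$ and each $\mathbf{x}\in S$, run the subroutine on $M,\mathbf{x},K,L$ to get a set $Y$ and set $S':=\lfloor S'\cup Y\rfloor$; then, if $d_0\in\uparrow S'$, return True. Continue while $S\ne S'$. After the loop ends, return True if $d_0\in\uparrow S'$. (Termination is not guaranteed.) The algorithm for downward-closed $H$ is the order-dual adaptation: $\lfloor\cdot\rfloor$ and $\uparrow$ are replaced by $\lceil\cdot\rceil$ and $\downarrow$, and the subroutine instead computes $$\mathbf{y}_k^{*}\in\arg\max_{\mathbf{y}}\ \mathbf{1}^{T}\mathbf{y}\quad\text{subject to}\quad M^{T}\mathbf{y}\preceq\mathbf{x},\ \ \mathbf{1}^{T}\mathbf{y}\ge1,\ \ \mathbf{0}\preceq\mathbf{y}\preceq\mathbf{1},\ \ (\mathbf{y})_{\mathbf{q}_j}>(\mathbf{y}_j^{*})_{\mathbf{q}_j}\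 \text{for all } j<k .$$ *)

theory Defs
  imports "HOL-Analysis.Analysis"
begin

section \<open>Configurations and MDPs\<close>

text \<open>
  The state set is the (finite, nonempty) index type \<open>'q\<close>; it cannot be empty as soon as there is
  an initial configuration. The action set is an explicit finite set, which may be empty.
  The order \<open>\<le>\<close> on \<open>real ^ 'q\<close> is componentwise, and \<open>{0..1}\<close> is the unit cube.
\<close>

definition mass :: "real ^ 'q::finite \<Rightarrow> real" where
  "mass y = (\<Sum>q\<in>UNIV. y $ q)"

definition configurations :: "(real ^ 'q::finite) set" where
  "configurations = {d \<in> {0..1}. mass d = 1}"

definition stochastic :: "real ^ 'q ^ 'q::finite \<Rightarrow> bool" where
  "stochastic P \<longleftrightarrow> (\<forall>q. P $ q \<in> configurations)"

definition mdp :: "'a set \<Rightarrow> ('a \<Rightarrow> real ^ 'q ^ 'q::finite) \<Rightarrow> bool" where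
  "mdp Act M \<longleftrightarrow> finite Act \<and> (\<forall>a\<in>Act. stochastic (M a))"

definition step :: "('a \<Rightarrow> real ^ 'q ^ 'q::finite) \<Rightarrow> 'a \<Rightarrow> real ^ 'q \<Rightarrow> real ^ 'q" where
  "step M a d = transpose (M a) *v d"

text \<open>The actions in the list are played from left to right.\<close>

definition reachable ::
  "'a set \<Rightarrow> ('a \<Rightarrow> real ^ 'q ^ 'q::finite) \<Rightarrow> real ^ 'q \<Rightarrow> (real ^ 'q) set \<Rightarrow> bool" where
  "reachable Act M d\<^sub>0 H \<longleftrightarrow> (\<exists>as \<in> lists Act. fold (step M) as d\<^sub>0 \<in> H)"


section \<open>Monotone sets\<close>

definition up_closure :: "(real ^ 'q::finite) set \<Rightarrow> (real ^ 'q) set" where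
  "up_closure T = {y \<in> {0..1}. \<exists>x\<in>T. x \<le> y}"

definition down_closure :: "(real ^ 'q::finite) set \<Rightarrow> (real ^ 'q) set" where
  "down_closure T = {y \<in> {0..1}. \<exists>x\<in>T. y \<le> x}"

definition upward_closed :: "(real ^ 'q::finite) set \<Rightarrow> bool" where
  "upward_closed H \<longleftrightarrow> H = up_closure H"

definition downward_closed :: "(real ^ 'q::finite) set \<Rightarrow> bool" where
  "downward_closed H \<longleftrightarrow> H = down_closure H"

definition finitely_generated_up :: "(real ^ 'q::finite) set \<Rightarrow> bool" where
  "finitely_generated_up H \<longleftrightarrow> (\<exists>T. finite T \<and> T \<subseteq> {0..1} \<and> H = up_closure T)"

definition finitely_generated_down :: "(real ^ 'q::finite) set \<Rightarrow> bool" where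
  "finitely_generated_down H \<longleftrightarrow> (\<exists>T. finite T \<and> T \<subseteq> {0..1} \<and> H = down_closure T)"

definition minimals :: "(real ^ 'q::finite) set \<Rightarrow> (real ^ 'q) set" where
  "minimals T = {x \<in> T. \<not> (\<exists>y\<in>T. y < x)}"

definition maximals :: "(real ^ 'q::finite) set \<Rightarrow> (real ^ 'q) set" where
  "maximals T = {x \<in> T. \<not> (\<exists>y\<in>T. x < y)}"


section \<open>The optimization problems\<close>

text \<open>
  The list \<open>cs\<close> consists of the pairs of a sampled state and the earlier solution it constrains.
  The constraints on \<open>cs\<close> are strict, so the set of optimal solutions may be empty although the
  problem is feasible; in that case, too, no solution is returned.
\<close>

definition up_feasible ::
  "real ^ 'q ^ 'q::finite \<Rightarrow> real ^ 'q \<Rightarrow> ('q \<times> (real ^ 'q)) list \<Rightarrow> real ^ 'q \<Rightarrow> bool" where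
  "up_feasible P x cs y \<longleftrightarrow>
     x \<le> transpose P *v y \<and> mass y \<le> 1 \<and> 0 \<le> y \<and> (\<forall>(q, z) \<in> set cs. y $ q < z $ q)"

definition up_solutions ::
  "real ^ 'q ^ 'q::finite \<Rightarrow> real ^ 'q \<Rightarrow> ('q \<times> (real ^ 'q)) list \<Rightarrow> (real ^ 'q) set" where
  "up_solutions P x cs = {y. is_arg_min mass (up_feasible P x cs) y}"

definition down_feasible ::
  "real ^ 'q ^ 'q::finite \<Rightarrow> real ^ 'q \<Rightarrow> ('q \<times> (real ^ 'q)) list \<Rightarrow> real ^ 'q \<Rightarrow> bool" where
  "down_feasible P x cs y \<longleftrightarrow>
     transpose P *v y \<le> x \<and> 1 \<le> mass y \<and> 0 \<le> y \<and> y \<le> 1 \<and> (\<forall>(q, z) \<in> set cs. z $ q < y $ q)"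

definition down_solutions ::
  "real ^ 'q ^ 'q::finite \<Rightarrow> real ^ 'q \<Rightarrow> ('q \<times> (real ^ 'q)) list \<Rightarrow> (real ^ 'q) set" where
  "down_solutions P x cs = {y. is_arg_max mass (down_feasible P x cs) y}"


section \<open>The algorithm\<close>

text \<open>
  The random choices, the choice of an optimal solution and the order in which the loop over
  matrices and antichain elements is executed are modelled by nondeterminism: each relation below
  relates an input to every possible outcome of a terminating run.

  In \<open>subroutine sol K L ys Y\<close>, the optimal solutions for given constraints are \<open>sol\<close>, the
  list \<open>ys\<close> holds the solutions \<open>y\<^sub>1, \<dots>, y\<^bsub>k-1\<^esub>\<close> found so far, and \<open>Y\<close> is the eventual output.
  The list \<open>qss\<close> consists of the samples in \<open>Q\<^bsup>k-1\<^esup>\<close> for which no solution was returned.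
\<close>

definition failed_samples ::
  "(('q::finite \<times> (real ^ 'q)) list \<Rightarrow> (real ^ 'q) set) \<Rightarrow> (real ^ 'q) list \<Rightarrow> 'q list list \<Rightarrow> bool" where
  "failed_samples sol ys qss \<longleftrightarrow>
     (\<forall>qs \<in> set qss. length qs = length ys \<and> sol (zip qs ys) = {})"

inductive subroutine ::
  "(('q::finite \<times> (real ^ 'q)) list \<Rightarrow> (real ^ 'q) set) \<Rightarrow> nat \<Rightarrow> nat \<Rightarrow>
   (real ^ 'q) list \<Rightarrow> (real ^ 'q) set \<Rightarrow> bool"
  for sol K L where
  enough: "length ys = K \<Longrightarrow> subroutine sol K L ys (set ys)"
| give_up: "length ys < K \<Longrightarrow> failed_samples sol ys qss \<Longrightarrow> length qss = L \<Longrightarrow>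
    subroutine sol K L ys (set ys)"
| found: "length ys < K \<Longrightarrow> failed_samples sol ys qss \<Longrightarrow> length qss < L \<Longrightarrow>
    length qs = length ys \<Longrightarrow> y \<in> sol (zip qs ys) \<Longrightarrow>
    subroutine sol K L (ys @ [y]) Y \<Longrightarrow> subroutine sol K L ys Y"

text \<open>
  Both variants of the algorithm are instances of one scheme: \<open>ext\<close> is \<open>minimals\<close> or \<open>maximals\<close>,
  \<open>cl\<close> is \<open>up_closure\<close> or \<open>down_closure\<close>, and \<open>sol\<close> is \<open>up_solutions\<close> or \<open>down_solutions\<close>.

  \<open>for_loop\<close> processes a list of pairs of a matrix and an antichain element, turning the value
  of \<open>S'\<close> before the loop (third-to-last argument) into its value after the loop.
\<close>

inductive for_loop ::
  "((real ^ 'q::finite) set \<Rightarrow> (real ^ 'q) set) \<Rightarrow>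
   (real ^ 'q ^ 'q \<Rightarrow> real ^ 'q \<Rightarrow> ('q \<times> (real ^ 'q)) list \<Rightarrow> (real ^ 'q) set) \<Rightarrow> nat \<Rightarrow> nat \<Rightarrow>
   (real ^ 'q) set \<Rightarrow> ((real ^ 'q ^ 'q) \<times> (real ^ 'q)) list \<Rightarrow> (real ^ 'q) set \<Rightarrow> bool"
  for ext sol K L where
  finish: "for_loop ext sol K L S' [] S'"
| body: "subroutine (sol P x) K L [] Y \<Longrightarrow> for_loop ext sol K L (ext (S' \<union> Y)) ps S'' \<Longrightarrow>
    for_loop ext sol K L S' ((P, x) # ps) S''"

definition iteration ::
  "((real ^ 'q::finite) set \<Rightarrow> (real ^ 'q) set) \<Rightarrow>
   (real ^ 'q ^ 'q \<Rightarrow> real ^ 'q \<Rightarrow> ('q \<times> (real ^ 'q)) list \<Rightarrow> (real ^ 'q) set) \<Rightarrow>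
   'a set \<Rightarrow> ('a \<Rightarrow> real ^ 'q ^ 'q) \<Rightarrow> (real ^ 'q) set \<Rightarrow> nat \<Rightarrow> nat \<Rightarrow>
   (real ^ 'q) set \<Rightarrow> (real ^ 'q) set \<Rightarrow> bool" where
  "iteration ext sol Act M H K L S S' \<longleftrightarrow>
     (\<exists>ps. distinct ps \<and> set ps = (M ` Act) \<times> S \<and> for_loop ext sol K L (ext H) ps S')"

text \<open>
  \<open>repeat_loop \<dots> S b\<close>: if \<open>S\<close> is the value of \<open>S'\<close> at the start of a pass through the body of
  the outer loop (and hence the value of \<open>S\<close> during that pass), the algorithm may return \<open>b\<close>.
\<close>

inductive repeat_loop ::
  "((real ^ 'q::finite) set \<Rightarrow> (real ^ 'q) set) \<Rightarrow> ((real ^ 'q) set \<Rightarrow> (real ^ 'q) set) \<Rightarrow>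
   (real ^ 'q ^ 'q \<Rightarrow> real ^ 'q \<Rightarrow> ('q \<times> (real ^ 'q)) list \<Rightarrow> (real ^ 'q) set) \<Rightarrow>
   'a set \<Rightarrow> ('a \<Rightarrow> real ^ 'q ^ 'q) \<Rightarrow> real ^ 'q \<Rightarrow> (real ^ 'q) set \<Rightarrow> nat \<Rightarrow> nat \<Rightarrow>
   (real ^ 'q) set \<Rightarrow> bool \<Rightarrow> bool"
  for ext cl sol Act M d\<^sub>0 H K L where
  return_true: "iteration ext sol Act M H K L S S' \<Longrightarrow> d\<^sub>0 \<in> cl S' \<Longrightarrow>
    repeat_loop ext cl sol Act M d\<^sub>0 H K L S True"
| repeat: "iteration ext sol Act M H K L S S' \<Longrightarrow> d\<^sub>0 \<notin> cl S' \<Longrightarrow> S \<noteq> S' \<Longrightarrow>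
    repeat_loop ext cl sol Act M d\<^sub>0 H K L S' b \<Longrightarrow>
    repeat_loop ext cl sol Act M d\<^sub>0 H K L S b"
| exit: "iteration ext sol Act M H K L S S' \<Longrightarrow> d\<^sub>0 \<notin> cl S' \<Longrightarrow> S = S' \<Longrightarrow>
    repeat_loop ext cl sol Act M d\<^sub>0 H K L S (d\<^sub>0 \<in> cl S')"

definition upward_algorithm ::
  "'a set \<Rightarrow> ('a \<Rightarrow> real ^ 'q ^ 'q::finite) \<Rightarrow> real ^ 'q \<Rightarrow> (real ^ 'q) set \<Rightarrow> nat \<Rightarrow> nat \<Rightarrow>
   bool \<Rightarrow> bool" where
  "upward_algorithm Act M d\<^sub>0 H K L b \<longleftrightarrow>
     repeat_loop minimals up_closure up_solutions Act M d\<^sub>0 H K L (minimals H) b"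

definition downward_algorithm ::
  "'a set \<Rightarrow> ('a \<Rightarrow> real ^ 'q ^ 'q::finite) \<Rightarrow> real ^ 'q \<Rightarrow> (real ^ 'q) set \<Rightarrow> nat \<Rightarrow> nat \<Rightarrow>
   bool \<Rightarrow> bool" where
  "downward_algorithm Act M d\<^sub>0 H K L b \<longleftrightarrow>
     repeat_loop maximals down_closure down_solutions Act M d\<^sub>0 H K L (maximals H) b"

end

theory Submission
  imports Defs
begin

text \<open>
  Call a vector winning if \<open>H\<close> is reachable from every configuration above it (below it, in the dual
  case). All elements of \<open>H\<close> are winning because \<open>H\<close> is monotone. If \<open>x\<close> is winning and
  \<open>x \<preceq> M\<^sub>a\<^sup>T y\<close>, then so is \<open>y\<close>: since \<open>M\<^sub>a\<close> is nonnegative, playing \<open>a\<close> from a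
  configuration above \<open>y\<close> leads to a configuration above \<open>x\<close>. Hence the antichains computed by
  the algorithm only ever contain winning vectors.
\<close>

text \<open>The output lists \<open>ys\<close> together with later picks, each taken from some
  \<open>sol cs\<close>, whatever the samples were.\<close>

lemma subroutine_subset:
  assumes "subroutine sol K L ys Y" "set ys \<subseteq> W" "\<And>cs. sol cs \<subseteq> W"
  shows "Y \<subseteq> W"
  using assms by (induction rule: subroutine.induct) auto

text \<open>\<open>ext\<close> only discards elements, so \<open>W\<close> can be left only through
  a solution. The bound on \<open>sol\<close> is asked for pairs in \<open>ps\<close> alone, since
  it will hold only for matrices of actions and winning \<open>x\<close>.\<close>

lemma for_loop_subset:
  assumes "for_loop ext sol K L S' ps S''" "S' \<subseteq> W"
    and "\<And>T. ext T \<subseteq> T" "\<And>P x cs. (P, x) \<in> set ps \<Longrightarrow> sol P x cs \<subseteq> W"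
  shows "S'' \<subseteq> W"
  using assms
proof (induction rule: for_loop.induct)
  case (body P x Y S' ps S'')
  from body.hyps(1) have "Y \<subseteq> W"
    by (rule subroutine_subset) (use body.prems in auto)
  with body.prems(1,2) have "ext (S' \<union> Y) \<subseteq> W"
    by (meson Un_least order_trans)
  with body show ?case by simp
qed simp

lemma iteration_subset:
  assumes "iteration ext sol Act M H K L S S'" "S \<subseteq> W" "H \<subseteq> W" "\<And>T. ext T \<subseteq> T"
    and "\<And>a x cs. a \<in> Act \<Longrightarrow> x \<in> W \<Longrightarrow> sol (M a) x cs \<subseteq> W"
  shows "S' \<subseteq> W"
proof -
  from assms(1) obtain ps where ps: "set ps = (M ` Act) \<times> S" "for_loop ext sol K L (ext H) ps S'"
    unfolding iteration_def by blast
  show ?thesis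
  proof (rule for_loop_subset[OF ps(2)])
    show "ext H \<subseteq> W" using assms(3,4) by (rule order_trans[rotated])
  next
    fix P x cs assume "(P, x) \<in> set ps"
    \<comment> \<open>The loop runs over matrices; an action is recovered because reachability is
      phrased with actions.\<close>
    then obtain a where "a \<in> Act" "P = M a" "x \<in> W"
      using ps(1) assms(2) by auto
    then show "sol P x cs \<subseteq> W" using assms(5) by simp
  qed (rule assms(4))
qed

lemma repeat_loop_subset:
  assumes "repeat_loop ext cl sol Act M d\<^sub>0 H K L S b" "b" "S \<subseteq> W" "H \<subseteq> W" "\<And>T. ext T \<subseteq> T"
    and "\<And>a x cs. a \<in> Act \<Longrightarrow> x \<in> W \<Longrightarrow> sol (M a) x cs \<subseteq> W"
  shows "\<exists>S'\<subseteq>W. d\<^sub>0 \<in> cl S'"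
  using assms
proof (induction rule: repeat_loop.induct)
  case (return_true S S')
  have "S' \<subseteq> W"
    by (rule iteration_subset[OF return_true.hyps(1)]) (fact return_true.prems)+
  with return_true.hyps(2) show ?case by blast
next
  case (repeat S S' b)
  have "S' \<subseteq> W"
    by (rule iteration_subset[OF repeat.hyps(1)]) (fact repeat.prems)+
  then show ?case using repeat.prems by (intro repeat.IH)
\<comment> \<open>In the case \<open>exit\<close> the answer \<open>d\<^sub>0 \<in> cl S'\<close> is
  false by the premises of the rule, contradicting \<open>b\<close>.\<close>
qed simp

lemma transpose_mult_mono:
  assumes "stochastic P" "x \<le> y"
  shows "transpose P *v x \<le> transpose P *v y"
proof -
  have "0 \<le> P $ i $ j" for i j
    using assms(1) by (auto simp: stochastic_def configurations_def less_eq_vec_def)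
  then show ?thesis
    using assms(2)
    by (auto simp: less_eq_vec_def matrix_vector_mult_def transpose_def intro!: sum_mono mult_left_mono)
qed

text \<open>Swapping the sums turns the new mass into row sums of \<open>M a\<close>, which are 1.
  This keeps plays where winning is defined.\<close>

lemma step_configurations:
  assumes "stochastic (M a)" "d \<in> configurations"
  shows "step M a d \<in> configurations"
proof -
  let ?P = "M a"
  have P0: "0 \<le> ?P $ i $ j" and P1: "(\<Sum>j\<in>UNIV. ?P $ i $ j) = 1" for i j
    using assms(1) by (auto simp: stochastic_def configurations_def less_eq_vec_def mass_def)
  have d0: "0 \<le> d $ i" and d1: "(\<Sum>i\<in>UNIV. d $ i) = 1" for i
    using assms(2) by (auto simp: configurations_def less_eq_vec_def mass_def)
  have comp: "step M a d $ j = (\<Sum>i\<in>UNIV. ?P $ i $ j * d $ i)" for j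
    by (simp add: step_def matrix_vector_mult_def transpose_def)
  have nonneg: "0 \<le> step M a d $ j" for j
    unfolding comp by (intro sum_nonneg mult_nonneg_nonneg P0 d0)
  have "mass (step M a d) = (\<Sum>i\<in>UNIV. \<Sum>j\<in>UNIV. ?P $ i $ j * d $ i)"
    unfolding mass_def comp by (rule sum.swap)
  also have "\<dots> = 1"
    by (simp add: sum_distrib_right[symmetric] P1 d1)
  finally have mass: "mass (step M a d) = 1" .
  \<comment> \<open>A nonnegative coordinate is at most the total mass 1, which gives the upper
    bound of the cube.\<close>
  have "step M a d $ j \<le> mass (step M a d)" for j
    unfolding mass_def by (rule member_le_sum) (auto simp: nonneg)
  then show ?thesis
    using nonneg mass by (auto simp: configurations_def less_eq_vec_def)
qed

lemma reachable_step:
  assumes "a \<in> Act" "reachable Act M (step M a d) H"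
  shows "reachable Act M d H"
proof -
  from assms(2) obtain as where "as \<in> lists Act" "fold (step M) as (step M a d) \<in> H"
    unfolding reachable_def by blast
  then show ?thesis
    unfolding reachable_def using assms(1) by (intro bexI[of _ "a # as"]) auto
qed

lemma reachable_refl: "d \<in> H \<Longrightarrow> reachable Act M d H"
  unfolding reachable_def by (intro bexI[of _ "[]"]) auto

lemma upward_algorithm_sound:
  assumes mdp: "mdp Act M" and d0: "d\<^sub>0 \<in> configurations"
    and H: "upward_closed H" and run: "upward_algorithm Act M d\<^sub>0 H K L True"
  shows "reachable Act M d\<^sub>0 H"
proof -
  \<comment> \<open>Only \<open>d\<close> ranges over configurations: the vectors \<open>x\<close>
    in the antichains may have another mass, and those of mass above 1 are winning
    vacuously.\<close>
  define W where "W = {x. \<forall>d\<in>configurations. x \<le> d \<longrightarrow> reachable Act M d H}"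
  have HW: "H \<subseteq> W"
  proof -
    have "d \<in> H" if "x \<in> H" "d \<in> configurations" "x \<le> d" for x d
    proof -
      have "d \<in> up_closure H"
        using that by (auto simp: up_closure_def configurations_def)
      then show ?thesis using H by (simp add: upward_closed_def)
    qed
    then show ?thesis by (auto simp: W_def intro: reachable_refl)
  qed
  have pre: "up_solutions (M a) x cs \<subseteq> W" if a: "a \<in> Act" and x: "x \<in> W" for a x cs
  proof
    fix y assume "y \<in> up_solutions (M a) x cs"
    then have y: "x \<le> transpose (M a) *v y"
      by (simp add: up_solutions_def is_arg_min_def up_feasible_def)
    have st: "stochastic (M a)" using mdp a by (simp add: mdp_def)
    have "reachable Act M d H" if d: "d \<in> configurations" "y \<le> d" for d
    proof (rule reachable_step[OF a])
      have "x \<le> step M a d"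
        using y transpose_mult_mono[OF st d(2)] unfolding step_def by (rule order_trans)
      then show "reachable Act M (step M a d) H"
        using x step_configurations[where M=M, OF st d(1)] by (simp add: W_def)
    qed
    then show "y \<in> W" by (simp add: W_def)
  qed
  have ext: "minimals T \<subseteq> T" for T :: "(real ^ 'b) set"
    by (auto simp: minimals_def)
  have "\<exists>S'\<subseteq>W. d\<^sub>0 \<in> up_closure S'"
    \<comment> \<open>The open premise is that the initial antichain \<open>minimals H\<close> lies
      in \<open>W\<close>.\<close>
    by (rule repeat_loop_subset[OF run[unfolded upward_algorithm_def] TrueI _ HW ext pre])
       (use ext HW in auto)
  then show ?thesis using d0 by (auto simp: up_closure_def W_def)
qed

lemma downward_algorithm_sound:
  assumes mdp: "mdp Act M" and d0: "d\<^sub>0 \<in> configurations"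
    and H: "downward_closed H" and run: "downward_algorithm Act M d\<^sub>0 H K L True"
  shows "reachable Act M d\<^sub>0 H"
proof -
  \<comment> \<open>Dually, the vacuously winning vectors include those of mass below 1.\<close>
  define W where "W = {x. \<forall>d\<in>configurations. d \<le> x \<longrightarrow> reachable Act M d H}"
  have HW: "H \<subseteq> W"
  proof -
    have "d \<in> H" if "x \<in> H" "d \<in> configurations" "d \<le> x" for x d
    proof -
      have "d \<in> down_closure H"
        using that by (auto simp: down_closure_def configurations_def)
      then show ?thesis using H by (simp add: downward_closed_def)
    qed
    then show ?thesis by (auto simp: W_def intro: reachable_refl)
  qed
  have pre: "down_solutions (M a) x cs \<subseteq> W" if a: "a \<in> Act" and x: "x \<in> W" for a x cs
  proof
    fix y assume "y \<in> down_solutions (M a) x cs"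
    then have y: "transpose (M a) *v y \<le> x"
      by (simp add: down_solutions_def is_arg_max_def down_feasible_def)
    have st: "stochastic (M a)" using mdp a by (simp add: mdp_def)
    have "reachable Act M d H" if d: "d \<in> configurations" "d \<le> y" for d
    proof (rule reachable_step[OF a])
      \<comment> \<open>The chain is now \<open>step M a d\<close> \<le>
        \<open>transpose (M a) *v y\<close> \<le> \<open>x\<close>.\<close>
      have "step M a d \<le> x"
        using transpose_mult_mono[OF st d(2)] y unfolding step_def by (rule order_trans)
      then show "reachable Act M (step M a d) H"
        using x step_configurations[where M=M, OF st d(1)] by (simp add: W_def)
    qed
    then show "y \<in> W" by (simp add: W_def)
  qed
  have ext: "maximals T \<subseteq> T" for T :: "(real ^ 'b) set"
    by (auto simp: maximals_def)
  have "\<exists>S'\<subseteq>W. d\<^sub>0 \<in> down_closure S'"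
    by (rule repeat_loop_subset[OF run[unfolded downward_algorithm_def] TrueI _ HW ext pre])
       (use ext HW in auto)
  then show ?thesis using d0 by (auto simp: down_closure_def W_def)
qed

theorem theorem29:
  fixes Act :: "'a set" and M :: "'a \<Rightarrow> real ^ 'q ^ 'q::finite"
    and d\<^sub>0 :: "real ^ 'q" and H :: "(real ^ 'q) set" and K L :: nat
  assumes "mdp Act M"
    and "d\<^sub>0 \<in> configurations"
  shows "(upward_closed H \<and> finitely_generated_up H \<and>
            upward_algorithm Act M d\<^sub>0 H K L True \<longrightarrow> reachable Act M d\<^sub>0 H) \<and>
         (downward_closed H \<and> finitely_generated_down H \<and>
            downward_algorithm Act M d\<^sub>0 H K L True \<longrightarrow> reachable Act M d\<^sub>0 H)"
  using assms upward_algorithm_sound downward_algorithm_sound by blast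

end
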